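(* Let $\mathbf{F}_q$ be a finite field with $q$ elements, $n$ a positive integer, $f\in MF_n^n(\mathbf{F}_q)$ a monomial dynamical system and $F\in M(n\times n;E_q)$ its corresponding matrix. Put $t:=\lceil\log_2(q^n-1)\rceil$, $A:=F^{\cdot 2^t}$ and $B:=F\cdot A$, where all products and powers are taken in the monoid $M(n\times n;E_q)$. Then $f$ is a fixed point system if and only if $A=B$. Computing $A$ by $t$ successive squarings and $B$ by one further multiplication, and then comparing the entries of $A$ and $B$, decides whether $f$ is a fixed point system using at most $$N(n,q):=(2n^3-n^2)(n\log_2(q)+2)+n^2$$ operations (additions and multiplications in $E_q$, and comparisons of elements of $E_q$). In particular $N(n,q)\in O(n^4)$ for fixed $q$, and $N(n,q)\in O(n^4\log_2(q))$ for $n,q\to\infty$.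
   Context: Convention: $x^0=1$ for all $x\in\mathbf{F}_q$. For $c\in\mathbb{N}_0$, $red_q(c)$ denotes the degree of the (unique) remainder of the polynomial division of $\tau^c$ by $\tau^q-\tau$ in $\mathbf{F}_q[\tau]$. The exponents semiring is $E_q=\{0,1,\dots,q-1\}$ with $a\oplus b:=red_q(a+b)$ and $a\bullet b:=red_q(ab)$. $M(n\times n;E_q)$ is the monoid of $n\times n$ matrices over $E_q$ with product $\cdot$ defined through $\oplus$ and $\bullet$, and $F^{\cdot m}$ denotes the $m$-th power of $F$ in this monoid. A monomial dynamical system $f\in MF_n^n(\mathbf{F}_q)$ is a map $f:\mathbf{F}_q^n\to\mathbf{F}_q^n$ for which there is a (necessarily unique) matrix $F\in M(n\times n;E_q)$, the corresponding matrix of $f$, such that $f_i(x)=x_1^{F_{i1}}\cdots x_n^{F_{in}}$ for all $x\in\mathbf{F}_q^n$ and all $i$. $f$ is a fixed point system if every trajectory $x,f(x),f^2(x),\dots$ ends in a fixed point of $f$. A matrix multiplication is carried out by the standard method, using $2n^3-n^2$ additions or multiplications of entries. *)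

theory Defs
  imports
    "HOL-Computational_Algebra.Polynomial"
    "HOL-Library.Cardinality"
    "HOL-Library.Landau_Symbols"
    "HOL-Library.Monad_Syntax"
    "Jordan_Normal_Form.Matrix"
begin

text \<open>
  The finite field \<open>F\<^sub>q\<close> is a type \<open>'a\<close> of sort \<open>{finite, field}\<close>, with \<open>q = CARD('a)\<close>.
\<close>

definition red_modulus :: "'a::{finite, field} poly"
  where "red_modulus = monom 1 CARD('a) - monom 1 1"

definition red :: "'a::{finite, field} itself \<Rightarrow> nat \<Rightarrow> nat"
  where "red _ c = degree ((monom 1 c :: 'a poly) mod red_modulus)"

lemma card_field_ge_2: "CARD('a::{finite, field}) \<ge> 2"
proof -
  have "card {0, 1 :: 'a} \<le> CARD('a)"
    by (intro card_mono) auto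
  then show ?thesis
    by simp
qed

lemma degree_red_modulus: "degree (red_modulus :: 'a::{finite, field} poly) = CARD('a)"
proof -
  have "degree (monom 1 CARD('a) + - monom 1 1 :: 'a poly) = degree (monom 1 CARD('a) :: 'a poly)"
    using card_field_ge_2[where 'a = 'a]
    by (intro degree_add_eq_left) (simp add: degree_monom_eq)
  then show ?thesis
    by (simp add: degree_monom_eq red_modulus_def)
qed

lemma mod_less_red_modulus:
  assumes "c < CARD('a)"
  shows "(monom 1 c :: 'a::{finite, field} poly) mod red_modulus = monom 1 c"
  using assms by (intro mod_poly_less) (simp add: degree_red_modulus degree_monom_eq)

lemma red_less_eq: "c < CARD('a::{finite, field}) \<Longrightarrow> red TYPE('a) c = c"
  by (simp add: red_def mod_less_red_modulus degree_monom_eq)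

lemma monom_mod_red_modulus:
  "\<exists>d < CARD('a). (monom 1 c :: 'a::{finite, field} poly) mod red_modulus = monom 1 d"
proof (induction c rule: less_induct)
  case (less c)
  show ?case
  proof (cases "c < CARD('a)")
    case True
    then show ?thesis
      using mod_less_red_modulus by blast
  next
    case False
    define e where "e = c - CARD('a)"
    have c: "c = CARD('a) + e"
      using False by (simp add: e_def)
    have "(monom 1 c :: 'a poly) = monom 1 (Suc e) + monom 1 e * red_modulus"
      by (simp add: c red_modulus_def right_diff_distrib mult_monom add.commute)
    then have "(monom 1 c :: 'a poly) mod red_modulus = monom 1 (Suc e) mod red_modulus"
      by (metis mod_mult_self1)
    moreover have "Suc e < c"
      using card_field_ge_2[where 'a = 'a] by (simp add: c)
    ultimately show ?thesis
      using less.IH by metis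
  qed
qed

lemma monom_red:
  "(monom 1 (red TYPE('a) c) :: 'a::{finite, field} poly) = monom 1 c mod red_modulus"
  using monom_mod_red_modulus[where 'a = 'a, of c] by (auto simp: red_def degree_monom_eq)

lemma red_less: "red TYPE('a::{finite, field}) c < CARD('a)"
  using monom_mod_red_modulus[where 'a = 'a, of c] by (auto simp: red_def degree_monom_eq)

lemma red_add_left: "red TYPE('a::{finite, field}) (red TYPE('a) a + b) = red TYPE('a) (a + b)"
proof -
  have "(monom 1 (red TYPE('a) a + b) :: 'a poly) mod red_modulus
      = (monom 1 (red TYPE('a) a) * monom 1 b) mod red_modulus"
    by (simp add: mult_monom)
  also have "\<dots> = (monom 1 a * monom 1 b) mod red_modulus"
    by (simp only: monom_red mod_mult_left_eq)
  also have "\<dots> = monom 1 (a + b) mod red_modulus"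
    by (simp add: mult_monom)
  finally show ?thesis
    by (simp only: red_def)
qed

lemma red_add_right: "red TYPE('a::{finite, field}) (a + red TYPE('a) b) = red TYPE('a) (a + b)"
  using red_add_left[where 'a = 'a, of b a] by (simp add: add.commute)

lemma red_mult_left: "red TYPE('a::{finite, field}) (red TYPE('a) a * b) = red TYPE('a) (a * b)"
proof -
  have "(monom 1 (red TYPE('a) a * b) :: 'a poly) mod red_modulus
      = (monom 1 (red TYPE('a) a)) ^ b mod red_modulus"
    by (simp add: monom_power)
  also have "\<dots> = (monom 1 a) ^ b mod red_modulus"
    by (simp only: monom_red power_mod)
  also have "\<dots> = monom 1 (a * b) mod red_modulus"
    by (simp add: monom_power)
  finally show ?thesis
    by (simp only: red_def)
qed

lemma red_mult_right: "red TYPE('a::{finite, field}) (a * red TYPE('a) b) = red TYPE('a) (a * b)"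
  using red_mult_left[where 'a = 'a, of b a] by (simp add: mult.commute)

typedef (overloaded) 'a exponent = "{0..<CARD('a::{finite, field})}"
  morphisms nat_of_exponent Abs_exponent
  by (intro exI[of _ 0]) simp

setup_lifting type_definition_exponent

instantiation exponent :: ("{finite, field}") comm_semiring_1
begin

lift_definition zero_exponent :: "'a exponent" is 0
  by simp

lift_definition one_exponent :: "'a exponent" is 1
  using card_field_ge_2[where 'a = 'a] by simp

lift_definition plus_exponent :: "'a exponent \<Rightarrow> 'a exponent \<Rightarrow> 'a exponent"
  is "\<lambda>a b. red TYPE('a) (a + b)"
  by (simp add: red_less)

lift_definition times_exponent :: "'a exponent \<Rightarrow> 'a exponent \<Rightarrow> 'a exponent"
  is "\<lambda>a b. red TYPE('a) (a * b)"
  by (simp add: red_less)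

instance
proof
  fix a b c :: "'a exponent"
  show "a + b + c = a + (b + c)"
    by transfer (simp add: red_add_left red_add_right add.assoc)
  show "a + b = b + a"
    by transfer (simp add: add.commute)
  show "0 + a = a"
    by transfer (simp add: red_less_eq)
  show "a * b * c = a * (b * c)"
    by transfer (simp add: red_mult_left red_mult_right mult.assoc)
  show "a * b = b * a"
    by transfer (simp add: mult.commute)
  show "1 * a = a"
    by transfer (simp add: red_less_eq)
  show "0 * a = 0" "a * 0 = 0"
    by (transfer, simp add: red_less_eq)+
  show "(a + b) * c = a * c + b * c"
    by transfer (simp add: red_add_left red_add_right red_mult_left distrib_right)
  show "(0 :: 'a exponent) \<noteq> 1"
    by transfer simp
qed

end

text \<open>
  Points of \<open>F\<^sub>q\<^sup>n\<close> are the elements of \<^term>\<open>carrier_vec n\<close>, and \<open>M(n \<times> n; E\<^sub>q)\<close> is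
  \<^term>\<open>carrier_mat n n\<close> over the semiring \<^typ>\<open>'a exponent\<close>. Indices start at 0.
\<close>

definition corresponding_matrix ::
    "nat \<Rightarrow> ('a::{finite, field} vec \<Rightarrow> 'a vec) \<Rightarrow> 'a exponent mat \<Rightarrow> bool"
  where "corresponding_matrix n f F \<longleftrightarrow>
    F \<in> carrier_mat n n \<and>
    (\<forall>x \<in> carrier_vec n. \<forall>i < n. f x $ i = (\<Prod>j<n. x $ j ^ nat_of_exponent (F $$ (i, j))))"

definition monomial_dynamical_system ::
    "nat \<Rightarrow> ('a::{finite, field} vec \<Rightarrow> 'a vec) \<Rightarrow> bool"
  where "monomial_dynamical_system n f \<longleftrightarrow>
    f \<in> carrier_vec n \<rightarrow> carrier_vec n \<and> (\<exists>F. corresponding_matrix n f F)"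

definition fixed_point_system :: "nat \<Rightarrow> ('a vec \<Rightarrow> 'a vec) \<Rightarrow> bool"
  where "fixed_point_system n f \<longleftrightarrow>
    (\<forall>x \<in> carrier_vec n. \<exists>k. f ((f ^^ k) x) = (f ^^ k) x)"

text \<open>
  A computation yields a result together with the number of operations it performed. The only
  primitives that look at matrix entries are \<open>add_op\<close>, \<open>mult_op\<close> and \<open>eq_op\<close>, each of cost 1.
\<close>

datatype 'b counted = Counted (result: 'b) (cost: nat)

definition return :: "'b \<Rightarrow> 'b counted"
  where "return b = Counted b 0"

definition bind_counted :: "'b counted \<Rightarrow> ('b \<Rightarrow> 'c counted) \<Rightarrow> 'c counted"
  where "bind_counted m k = Counted (result (k (result m))) (cost m + cost (k (result m)))"

adhoc_overloading Monad_Syntax.bind \<rightleftharpoons> bind_counted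

primrec map_counted :: "('b \<Rightarrow> 'c counted) \<Rightarrow> 'b list \<Rightarrow> 'c list counted"
  where
    "map_counted k [] = return []"
  | "map_counted k (b # bs) = do {
       c \<leftarrow> k b;
       cs \<leftarrow> map_counted k bs;
       return (c # cs)
     }"

definition add_op :: "'b::plus \<Rightarrow> 'b \<Rightarrow> 'b counted"
  where "add_op a b = Counted (a + b) 1"

definition mult_op :: "'b::times \<Rightarrow> 'b \<Rightarrow> 'b counted"
  where "mult_op a b = Counted (a * b) 1"

definition eq_op :: "'b \<Rightarrow> 'b \<Rightarrow> bool counted"
  where "eq_op a b = Counted (a = b) 1"

text \<open>
  The entry \<open>a\<^sub>i\<^sub>0 b\<^sub>0\<^sub>j + \<dots> + a\<^sub>i\<^sub>m b\<^sub>m\<^sub>j\<close> of a product, with \<open>m + 1\<close> multiplications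
  and \<open>m\<close> additions; \<open>m = n - 1\<close> for matrices of size \<open>n \<ge> 1\<close>.
\<close>

primrec entry_counted :: "'b::{plus, times} mat \<Rightarrow> 'b mat \<Rightarrow> nat \<Rightarrow> nat \<Rightarrow> nat \<Rightarrow> 'b counted"
  where
    "entry_counted A B i j 0 = mult_op (A $$ (i, 0)) (B $$ (0, j))"
  | "entry_counted A B i j (Suc m) = do {
       s \<leftarrow> entry_counted A B i j m;
       p \<leftarrow> mult_op (A $$ (i, Suc m)) (B $$ (Suc m, j));
       add_op s p
     }"

definition mat_mult_counted :: "nat \<Rightarrow> 'b::{plus, times} mat \<Rightarrow> 'b mat \<Rightarrow> 'b mat counted"
  where "mat_mult_counted n A B = do {
    rows \<leftarrow> map_counted (\<lambda>i. map_counted (\<lambda>j. entry_counted A B i j (n - 1)) [0..<n]) [0..<n];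
    return (mat_of_rows_list n rows)
  }"

definition mat_eq_counted :: "nat \<Rightarrow> 'b mat \<Rightarrow> 'b mat \<Rightarrow> bool counted"
  where "mat_eq_counted n A B = do {
    es \<leftarrow> map_counted (\<lambda>(i, j). eq_op (A $$ (i, j)) (B $$ (i, j))) (List.product [0..<n] [0..<n]);
    return (list_all id es)
  }"

primrec squarings_counted :: "nat \<Rightarrow> nat \<Rightarrow> 'b::{plus, times} mat \<Rightarrow> 'b mat counted"
  where
    "squarings_counted n 0 F = return F"
  | "squarings_counted n (Suc t) F = do {
       A \<leftarrow> squarings_counted n t F;
       mat_mult_counted n A A
     }"

definition fixed_point_test ::
    "nat \<Rightarrow> nat \<Rightarrow> 'b::{plus, times} mat \<Rightarrow> ('b mat \<times> 'b mat \<times> bool) counted"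
  where "fixed_point_test n t F = do {
    A \<leftarrow> squarings_counted n t F;
    B \<leftarrow> mat_mult_counted n F A;
    b \<leftarrow> mat_eq_counted n A B;
    return (A, B, b)
  }"

definition op_bound :: "nat \<Rightarrow> nat \<Rightarrow> real"
  where "op_bound n q = (2 * real n ^ 3 - real n ^ 2) * (real n * log 2 (real q) + 2) + real n ^ 2"

lemma cost_entry_counted: "cost (entry_counted A B i j m) = 2 * m + 1"
  by (induction m) (simp_all add: bind_counted_def add_op_def mult_op_def)

lemma cost_map_counted: "cost (map_counted k bs) = (\<Sum>b\<leftarrow>bs. cost (k b))"
  by (induction bs) (simp_all add: bind_counted_def return_def)

lemma cost_mat_mult_counted: "cost (mat_mult_counted n A B) = 2 * n ^ 3 - n ^ 2"
proof (cases n)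
  case (Suc m)
  have "cost (mat_mult_counted n A B) = n * (n * (2 * m + 1))"
    by (simp add: mat_mult_counted_def bind_counted_def return_def cost_map_counted
        cost_entry_counted Suc sum_list_triv del: upt_Suc)
  also have "\<dots> = 2 * n ^ 3 - n ^ 2"
    by (simp add: Suc power2_eq_square power3_eq_cube algebra_simps)
  finally show ?thesis .
qed (simp add: mat_mult_counted_def bind_counted_def return_def)

end

theory Submission
  imports Defs
begin

text \<open>
  Composition of monomial systems corresponds to the product of their matrices, and a monomial
  function determines its exponents: two monomials of degree below \<open>q\<close> that agree on all \<open>q\<close>
  points are equal as polynomials. Hence \<open>A = B\<close> says that \<open>f\<^bsup>2^t\<^esup> = f\<^bsup>2^t+1\<^esup>\<close> on \<open>F\<^sub>q\<^sup>n\<close>,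
  which makes \<open>f\<close> a fixed point system. Conversely, a trajectory that ends in a fixed point visits
  distinct points until it reaches it, so it does so after at most \<open>q\<^sup>n - 1 \<le> 2\<^sup>t\<close> steps.
\<close>

section \<open>Exponents of monomial functions\<close>

text \<open>Multiplication by a nonzero \<open>a\<close> permutes the nonzero elements, so their
  product \<open>P\<close> equals \<open>a ^ (q - 1) * P\<close>; cancelling \<open>P\<close> gives
  \<open>a ^ (q - 1) = 1\<close>.\<close>

lemma finite_field_power_card:
  fixes a :: "'a::{finite, field}"
  shows "a ^ CARD('a) = a"
proof (cases "a = 0")
  case True
  then show ?thesis by simp
next
  case False
  define P where "P = \<Prod>(UNIV - {0 :: 'a})"
  have "bij_betw ((*) a) (UNIV - {0}) (UNIV - {0})"
    using False by (intro bij_betw_byWitness[where f' = "\<lambda>x. x / a"]) auto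
  then have "(\<Prod>x\<in>UNIV - {0}. a * x) = P"
    unfolding P_def by (intro prod.reindex_bij_betw)
  then have "a ^ card (UNIV - {0 :: 'a}) * P = P"
    by (simp add: prod.distrib P_def)
  moreover have "P \<noteq> 0"
    by (simp add: P_def)
  ultimately have "a ^ (CARD('a) - 1) = 1"
    by (simp add: card_Diff_singleton)
  then show ?thesis
    using card_field_ge_2[where 'a = 'a] power_minus_mult[of "CARD('a)" a] by simp
qed

text \<open>Every field element is a root of \<open>red_modulus\<close>, so passing to the remainder
  modulo it keeps all values. This makes arithmetic in the exponent semiring agree with exponent
  laws in the field.\<close>

lemma power_red:
  fixes a :: "'a::{finite, field}"
  shows "a ^ red TYPE('a) c = a ^ c"
proof -
  have "poly red_modulus a = 0"
    by (simp add: red_modulus_def poly_monom finite_field_power_card)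
  then have "poly (monom 1 c mod red_modulus) a = poly (monom 1 c) a"
    by (metis add.left_neutral div_mult_mod_eq mult_zero_right poly_add poly_mult)
  then show ?thesis
    by (simp add: poly_monom flip: monom_red)
qed

lemma nat_of_exponent_less: "nat_of_exponent (e :: 'a::{finite, field} exponent) < CARD('a)"
  using nat_of_exponent[of e] by simp

lemma power_exponent_one:
  fixes a :: "'a::{finite, field}"
  shows "a ^ nat_of_exponent (1 :: 'a exponent) = a"
  by (simp add: one_exponent.rep_eq)

lemma power_exponent_zero:
  fixes a :: "'a::{finite, field}"
  shows "a ^ nat_of_exponent (0 :: 'a exponent) = 1"
  by (simp add: zero_exponent.rep_eq)

lemma power_exponent_mult:
  fixes a :: "'a::{finite, field}"
  shows "a ^ nat_of_exponent (d * e :: 'a exponent)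
    = (a ^ nat_of_exponent e) ^ nat_of_exponent d"
  by (simp add: times_exponent.rep_eq power_red mult.commute flip: power_mult)

lemma power_exponent_sum:
  fixes a :: "'a::{finite, field}" and e :: "'b \<Rightarrow> 'a exponent"
  shows "a ^ nat_of_exponent (sum e S) = (\<Prod>j\<in>S. a ^ nat_of_exponent (e j))"
  by (induction S rule: infinite_finite_induct)
    (simp_all add: power_exponent_zero plus_exponent.rep_eq power_red power_add)

text \<open>The difference of the two monomials has degree at most q - 1 but q roots. Including
  \<open>a = 0\<close> matters: the exponents 0 and q - 1 give the same power of every nonzero
  \<open>a\<close> and differ only there, since \<open>0 ^ 0 = 1\<close>.\<close>

lemma exponent_eqI:
  fixes d e :: "'a::{finite, field} exponent"
  assumes "\<And>a :: 'a. a ^ nat_of_exponent d = a ^ nat_of_exponent e"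
  shows "d = e"
proof -
  define p :: "'a poly" where "p = monom 1 (nat_of_exponent d) - monom 1 (nat_of_exponent e)"
  have "degree p \<le> CARD('a) - 1"
    using nat_of_exponent_less[of d] nat_of_exponent_less[of e]
    by (simp add: p_def degree_diff_le degree_monom_eq)
  moreover have "{a. poly p a = 0} = UNIV"
    using assms by (simp add: p_def poly_monom)
  ultimately have "p = 0"
    using card_poly_roots_bound[of p] card_field_ge_2[where 'a = 'a] by fastforce
  then have "nat_of_exponent d = nat_of_exponent e"
    by (metis degree_monom_eq eq_iff_diff_eq_0 p_def zero_neq_one)
  then show ?thesis
    by (simp add: nat_of_exponent_inject)
qed

section \<open>Corresponding matrices\<close>

lemma corresponding_matrix_unique:
  assumes F: "corresponding_matrix n f F" and G: "corresponding_matrix n g G"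
    and fg: "\<And>x. x \<in> carrier_vec n \<Longrightarrow> f x = g x"
  shows "F = G"
proof (rule eq_matI)
  fix i j assume "i < dim_row G" "j < dim_col G"
  then have ij: "i < n" "j < n"
    using G by (auto simp: corresponding_matrix_def)
  show "F $$ (i, j) = G $$ (i, j)"
  proof (rule exponent_eqI)
    fix a :: 'a
    \<comment> \<open>With 1 in all coordinates except the j-th, every factor but the j-th is 1, so
      the entry \<open>(i, j)\<close> is tested alone against an arbitrary \<open>a\<close>.\<close>
    define x where "x = vec n (\<lambda>k. if k = j then a else 1)"
    have x: "x \<in> carrier_vec n"
      by (simp add: x_def)
    have single: "(\<Prod>k<n. x $ k ^ nat_of_exponent (H $$ (i, k))) = a ^ nat_of_exponent (H $$ (i, j))"
      for H :: "'a exponent mat"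
    proof -
      have "(\<Prod>k<n. x $ k ^ nat_of_exponent (H $$ (i, k)))
          = (\<Prod>k<n. if k = j then a ^ nat_of_exponent (H $$ (i, j)) else 1)"
        by (intro prod.cong) (auto simp: x_def)
      then show ?thesis
        using ij by simp
    qed
    have "f x $ i = a ^ nat_of_exponent (F $$ (i, j))"
      using F x ij by (simp add: corresponding_matrix_def single)
    moreover have "g x $ i = a ^ nat_of_exponent (G $$ (i, j))"
      using G x ij by (simp add: corresponding_matrix_def single)
    ultimately show "a ^ nat_of_exponent (F $$ (i, j)) = a ^ nat_of_exponent (G $$ (i, j))"
      using fg[OF x] by simp
  qed
qed (use F G in \<open>auto simp: corresponding_matrix_def\<close>)

lemma corresponding_matrix_one: "corresponding_matrix n (\<lambda>x. x) (1\<^sub>m n)"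
  unfolding corresponding_matrix_def
proof (intro conjI ballI allI impI)
  fix x :: "'a vec" and i assume i: "i < n"
  \<comment> \<open>The off-diagonal factors are zeroth powers, equal to 1 even where
    \<open>x $ j = 0\<close>.\<close>
  have "(\<Prod>j<n. x $ j ^ nat_of_exponent ((1\<^sub>m n :: 'a exponent mat) $$ (i, j)))
      = (\<Prod>j<n. if j = i then x $ i else 1)"
    using i by (intro prod.cong) (auto simp: power_exponent_one power_exponent_zero)
  then show "x $ i = (\<Prod>j<n. x $ j ^ nat_of_exponent ((1\<^sub>m n :: 'a exponent mat) $$ (i, j)))"
    using i by simp
qed simp

text \<open>Substituting one monomial map into the other raises \<open>x $ k\<close> to
  \<open>F $$ (i, j) * G $$ (j, k)\<close> for each \<open>j\<close>. Swapping the two products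
  collects these exponents into the entry \<open>(i, k)\<close> of the matrix product.\<close>

lemma corresponding_matrix_comp:
  assumes F: "corresponding_matrix n f F" and G: "corresponding_matrix n g G"
    and g: "g \<in> carrier_vec n \<rightarrow> carrier_vec n"
  shows "corresponding_matrix n (\<lambda>x. f (g x)) (F * G)"
  unfolding corresponding_matrix_def
proof (intro conjI ballI allI impI)
  have carrier: "F \<in> carrier_mat n n" "G \<in> carrier_mat n n"
    using F G by (simp_all add: corresponding_matrix_def)
  then show "F * G \<in> carrier_mat n n"
    by simp
  fix x :: "'a vec" and i assume x: "x \<in> carrier_vec n" and i: "i < n"
  have entry: "(F * G) $$ (i, k) = (\<Sum>j<n. F $$ (i, j) * G $$ (j, k))" if "k < n" for k
    using carrier i that by (simp add: scalar_prod_def atLeast0LessThan)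
  have "g x \<in> carrier_vec n"
    using g x by auto
  then have "f (g x) $ i = (\<Prod>j<n. g x $ j ^ nat_of_exponent (F $$ (i, j)))"
    using F i by (simp add: corresponding_matrix_def)
  also have "\<dots> = (\<Prod>j<n. \<Prod>k<n. x $ k ^ nat_of_exponent (F $$ (i, j) * G $$ (j, k)))"
    using G x by (intro prod.cong)
      (auto simp: corresponding_matrix_def power_exponent_mult prod_power_distrib)
  also have "\<dots> = (\<Prod>k<n. \<Prod>j<n. x $ k ^ nat_of_exponent (F $$ (i, j) * G $$ (j, k)))"
    by (rule prod.swap)
  also have "\<dots> = (\<Prod>k<n. x $ k ^ nat_of_exponent ((F * G) $$ (i, k)))"
    by (intro prod.cong refl) (simp only: lessThan_iff entry power_exponent_sum)
  finally show "f (g x) $ i = (\<Prod>k<n. x $ k ^ nat_of_exponent ((F * G) $$ (i, k)))" .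
qed

lemma funpow_carrier_vec:
  fixes f :: "'a vec \<Rightarrow> 'a vec"
  assumes "f \<in> carrier_vec n \<rightarrow> carrier_vec n" and "x \<in> carrier_vec n"
  shows "(f ^^ m) x \<in> carrier_vec n"
  using assms by (induction m) auto

lemma corresponding_matrix_funpow:
  assumes F: "corresponding_matrix n f F" and f: "f \<in> carrier_vec n \<rightarrow> carrier_vec n"
  shows "corresponding_matrix n (f ^^ m) (F ^\<^sub>m m)"
proof (induction m)
  case 0
  then show ?case
    using F corresponding_matrix_one[where 'a = 'a]
    by (auto simp: corresponding_matrix_def id_def)
next
  case (Suc m)
  \<comment> \<open>\<open>pow_mat\<close> puts the new factor on the right, so the extra
    \<open>f\<close> is applied first; \<open>funpow_swap1\<close> reconciles this with
    \<open>funpow\<close>.\<close>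
  have "corresponding_matrix n (\<lambda>x. (f ^^ m) (f x)) (F ^\<^sub>m m * F)"
    by (intro corresponding_matrix_comp Suc.IH F f)
  then show ?case
    by (simp add: funpow_swap1)
qed

section \<open>Trajectories\<close>

lemma finite_carrier_vec_finite_type: "finite (carrier_vec n :: 'a::finite vec set)"
  and card_carrier_vec_le: "card (carrier_vec n :: 'a::finite vec set) \<le> CARD('a) ^ n"
proof -
  let ?L = "{xs :: 'a list. set xs \<subseteq> UNIV \<and> length xs = n}"
  have eq: "(carrier_vec n :: 'a vec set) = vec_of_list ` ?L"
  proof (intro equalityI subsetI)
    fix v :: "'a vec" assume "v \<in> carrier_vec n"
    then show "v \<in> vec_of_list ` ?L"
      by (intro image_eqI[where x = "list_of_vec v"]) (auto simp: vec_list)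
  next
    fix v assume "v \<in> vec_of_list ` ?L"
    then show "v \<in> carrier_vec n"
      by (auto intro: carrier_vecI)
  qed
  have L: "finite ?L"
    by (rule finite_lists_length_eq) simp
  show "finite (carrier_vec n :: 'a vec set)"
    unfolding eq using L by (rule finite_imageI)
  show "card (carrier_vec n :: 'a vec set) \<le> CARD('a) ^ n"
    unfolding eq using card_image_le[OF L, of vec_of_list]
    by (simp only: card_lists_length_eq[OF finite])
qed

lemma funpow_fixed_le:
  assumes "f ((f ^^ k) x) = (f ^^ k) x" and "k \<le> m"
  shows "(f ^^ m) x = (f ^^ k) x"
  using assms(2) by (induction m rule: dec_induct) (simp_all add: assms(1))

text \<open>If the points at times \<open>i < j\<close> coincided, then \<open>k - j\<close> further
  steps from time \<open>i\<close> would already reach the fixed point, at time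
  \<open>i + (k - j) < k\<close>, against minimality of \<open>k\<close>.\<close>

lemma inj_on_funpow_before_fixed:
  assumes fixed: "f ((f ^^ k) x) = (f ^^ k) x"
    and least: "\<And>j. j < k \<Longrightarrow> f ((f ^^ j) x) \<noteq> (f ^^ j) x"
  shows "inj_on (\<lambda>j. (f ^^ j) x) {..k}"
proof (rule linorder_inj_onI)
  fix i j assume ij: "i < j" "j \<in> {..k}"
  show "(f ^^ i) x \<noteq> (f ^^ j) x"
  proof
    assume eq: "(f ^^ i) x = (f ^^ j) x"
    have "(f ^^ (i + (k - j))) x = (f ^^ (k - j)) ((f ^^ i) x)"
      by (metis add.commute comp_apply funpow_add)
    also have "\<dots> = (f ^^ k) x"
      using ij by (simp add: eq flip: funpow_add[THEN fun_cong, unfolded comp_def])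
    finally have "(f ^^ (i + (k - j))) x = (f ^^ k) x" .
    moreover have "i + (k - j) < k"
      using ij by auto
    ultimately show False
      using fixed least by metis
  qed
qed auto

lemma fixed_after_card:
  assumes "finite S" and "f \<in> S \<rightarrow> S" and "x \<in> S"
    and ex: "f ((f ^^ k) x) = (f ^^ k) x" and m: "card S - 1 \<le> m"
  shows "f ((f ^^ m) x) = (f ^^ m) x"
proof -
  define l where "l = (LEAST l. f ((f ^^ l) x) = (f ^^ l) x)"
  have l: "f ((f ^^ l) x) = (f ^^ l) x"
    unfolding l_def by (rule LeastI[of _ k]) (rule ex)
  have "(f ^^ j) x \<in> S" for j
    using assms(2,3) by (induction j) auto
  \<comment> \<open>The times 0 to \<open>l\<close> give \<open>l + 1\<close> distinct points of
    \<open>S\<close>, whence \<open>l <= card S - 1\<close>.\<close>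
  then have "card {..l} \<le> card S"
    using inj_on_funpow_before_fixed[OF l] not_less_Least assms(1)
    by (intro card_inj_on_le[of "\<lambda>j. (f ^^ j) x"]) (auto simp: l_def)
  then have "l \<le> m"
    using m by simp
  then show ?thesis
    using l by (simp only: funpow_fixed_le[OF l \<open>l \<le> m\<close>])
qed

text \<open>The two matrices represent \<open>f ^^ m\<close> and \<open>f\<close> after
  \<open>f ^^ m\<close>, so uniqueness turns their equality into equality of maps. A single
  \<open>m\<close> serves all starting points because the bound depends only on the number of
  points.\<close>

lemma fixed_point_system_iff_pow_mat:
  fixes f :: "'a::{finite, field} vec \<Rightarrow> 'a vec"
  assumes f: "f \<in> carrier_vec n \<rightarrow> carrier_vec n" and F: "corresponding_matrix n f F"
    and m: "CARD('a) ^ n - 1 \<le> m"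
  shows "fixed_point_system n f \<longleftrightarrow> F ^\<^sub>m m = F * F ^\<^sub>m m"
proof -
  have cm: "corresponding_matrix n (f ^^ m) (F ^\<^sub>m m)"
    by (rule corresponding_matrix_funpow[OF F f])
  have cSm: "corresponding_matrix n (\<lambda>x. f ((f ^^ m) x)) (F * F ^\<^sub>m m)"
    by (intro corresponding_matrix_comp F cm) (auto intro: funpow_carrier_vec[OF f])
  show ?thesis
  proof
    assume fps: "fixed_point_system n f"
    have "(f ^^ m) x = f ((f ^^ m) x)" if x: "x \<in> carrier_vec n" for x
    proof -
      obtain k where "f ((f ^^ k) x) = (f ^^ k) x"
        using fps x by (auto simp: fixed_point_system_def)
      moreover have "card (carrier_vec n :: 'a vec set) - 1 \<le> m"
        using m card_carrier_vec_le[where 'a = 'a, of n] by linarith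
      ultimately show ?thesis
        using fixed_after_card[OF finite_carrier_vec_finite_type f x] by metis
    qed
    then show "F ^\<^sub>m m = F * F ^\<^sub>m m"
      by (rule corresponding_matrix_unique[OF cm cSm])
  next
    assume "F ^\<^sub>m m = F * F ^\<^sub>m m"
    then have "corresponding_matrix n (\<lambda>x. f ((f ^^ m) x)) (F ^\<^sub>m m)"
      using cSm by simp
    then have "f ((f ^^ m) x) = (f ^^ m) x" if "x \<in> carrier_vec n" for x
      using that cm funpow_carrier_vec[OF f that, of m] funpow_carrier_vec[OF f that, of "Suc m"]
      by (intro eq_vecI) (auto simp: corresponding_matrix_def)
    then show "fixed_point_system n f"
      by (auto simp: fixed_point_system_def)
  qed
qed

section \<open>The counted test\<close>

lemma result_map_counted: "result (map_counted k bs) = map (\<lambda>b. result (k b)) bs"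
  by (induction bs) (simp_all add: bind_counted_def return_def)

lemma result_entry_counted:
  fixes A B :: "'b::semiring_0 mat"
  shows "result (entry_counted A B i j m) = (\<Sum>k\<le>m. A $$ (i, k) * B $$ (k, j))"
  by (induction m) (simp_all add: bind_counted_def add_op_def mult_op_def)

lemma result_mat_mult_counted:
  fixes A B :: "'b::semiring_0 mat"
  assumes "n \<ge> 1" and "A \<in> carrier_mat n n" and "B \<in> carrier_mat n n"
  shows "result (mat_mult_counted n A B) = A * B"
proof (rule eq_matI)
  fix i j assume "i < dim_row (A * B)" "j < dim_col (A * B)"
  then have ij: "i < n" "j < n"
    using assms by auto
  \<comment> \<open>\<open>entry_counted\<close> sums up to and including its last index;
    \<open>n >= 1\<close> ensures that this gives exactly \<open>n\<close> terms.\<close>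
  have "{..n - 1} = {0..<n}"
    using assms(1) by auto
  then show "result (mat_mult_counted n A B) $$ (i, j) = (A * B) $$ (i, j)"
    using ij assms(2,3)
    by (simp add: mat_mult_counted_def bind_counted_def return_def result_map_counted
        result_entry_counted mat_of_rows_list_def scalar_prod_def)
qed (use assms in \<open>simp_all add: mat_mult_counted_def bind_counted_def return_def
      result_map_counted mat_of_rows_list_def\<close>)

lemma result_mat_eq_counted:
  assumes "A \<in> carrier_mat n n" and "B \<in> carrier_mat n n"
  shows "result (mat_eq_counted n A B) \<longleftrightarrow> A = B"
proof -
  have "result (mat_eq_counted n A B) \<longleftrightarrow> (\<forall>i<n. \<forall>j<n. A $$ (i, j) = B $$ (i, j))"
    by (auto simp: mat_eq_counted_def bind_counted_def return_def result_map_counted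
        list_all_iff eq_op_def)
  also have "\<dots> \<longleftrightarrow> A = B"
    using assms by (auto intro!: eq_matI)
  finally show ?thesis .
qed

lemma cost_mat_eq_counted: "cost (mat_eq_counted n A B) = n ^ 2"
  by (simp add: mat_eq_counted_def bind_counted_def return_def cost_map_counted eq_op_def
      case_prod_unfold sum_list_triv power2_eq_square)

lemma pow_mat_add:
  fixes F :: "'b::semiring_1 mat"
  assumes "F \<in> carrier_mat n n"
  shows "F ^\<^sub>m (k + m) = F ^\<^sub>m k * F ^\<^sub>m m"
proof (induction m)
  case (Suc m)
  have "F ^\<^sub>m k \<in> carrier_mat n n" "F ^\<^sub>m m \<in> carrier_mat n n"
    using assms by simp_all
  with Suc assms show ?case
    by (simp add: assoc_mult_mat[of _ n n _ n _ n])
qed (use assms in simp)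

lemma result_squarings_counted:
  fixes F :: "'b::semiring_1 mat"
  assumes "n \<ge> 1" and "F \<in> carrier_mat n n"
  shows "result (squarings_counted n t F) = F ^\<^sub>m (2 ^ t)"
proof (induction t)
  case 0
  then show ?case
    using assms by (simp add: return_def)
next
  case (Suc t)
  have "F ^\<^sub>m (2 ^ t) \<in> carrier_mat n n"
    using assms by simp
  with Suc assms show ?case
    by (simp add: bind_counted_def result_mat_mult_counted mult_2 pow_mat_add)
qed

lemma cost_squarings_counted: "cost (squarings_counted n t F) = t * (2 * n ^ 3 - n ^ 2)"
  by (induction t) (simp_all add: bind_counted_def return_def cost_mat_mult_counted)

lemma result_fixed_point_test:
  fixes F :: "'b::semiring_1 mat"
  assumes "n \<ge> 1" and "F \<in> carrier_mat n n"
  shows "result (fixed_point_test n t F)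
    = (F ^\<^sub>m (2 ^ t), F * F ^\<^sub>m (2 ^ t), F ^\<^sub>m (2 ^ t) = F * F ^\<^sub>m (2 ^ t))"
proof -
  have "F ^\<^sub>m (2 ^ t) \<in> carrier_mat n n"
    using assms by simp
  with assms show ?thesis
    by (simp add: fixed_point_test_def bind_counted_def return_def result_squarings_counted
        result_mat_mult_counted result_mat_eq_counted)
qed

lemma cost_fixed_point_test:
  "cost (fixed_point_test n t F) = (2 * n ^ 3 - n ^ 2) * (t + 1) + n ^ 2"
  by (simp add: fixed_point_test_def bind_counted_def return_def cost_squarings_counted
      cost_mat_mult_counted cost_mat_eq_counted)

section \<open>The bound on the number of operations\<close>

lemma square_le_cube: "(n::nat) ^ 2 \<le> n ^ 3"
  by (cases "n = 0") (simp_all add: power_increasing)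

text \<open>The 1 in the hypothesis allows for rounding up the logarithm; the final product
  \<open>F * A\<close> adds another 1, which gives the 2 in \<open>op_bound\<close>.\<close>

lemma cost_fixed_point_test_le:
  assumes "real t \<le> real n * log 2 (real q) + 1"
  shows "real (cost (fixed_point_test n t F)) \<le> op_bound n q"
proof -
  \<comment> \<open>This keeps the subtraction of naturals from truncating, so it agrees with the
    real one.\<close>
  have "n ^ 2 \<le> 2 * n ^ 3"
    using square_le_cube[of n] by simp
  then have eq: "real (2 * n ^ 3 - n ^ 2) = 2 * real n ^ 3 - real n ^ 2"
    by (simp add: of_nat_diff)
  have "real (2 * n ^ 3 - n ^ 2) * (real t + 1)
      \<le> real (2 * n ^ 3 - n ^ 2) * (real n * log 2 (real q) + 2)"
    using assms by (intro mult_left_mono) auto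
  then show ?thesis
    unfolding cost_fixed_point_test op_bound_def eq[symmetric]
    by (simp only: of_nat_add of_nat_mult of_nat_power of_nat_1 add_le_cancel_right)
qed

text \<open>The constant is uniform in \<open>n\<close> and \<open>q\<close>, so the estimate yields
  both asymptotic claims; for fixed \<open>q\<close> the logarithm joins the constant.\<close>

lemma abs_op_bound_le:
  assumes "q \<ge> 2"
  shows "\<bar>op_bound n q\<bar> \<le> 7 * (real n ^ 4 * log 2 (real q))"
proof (cases "n = 0")
  case True
  then show ?thesis
    by (simp add: op_bound_def)
next
  case False
  define L where "L = log 2 (real q)"
  have L: "1 \<le> L"
    using assms by (simp add: L_def)
  have n: "1 \<le> real n"
    using False by simp
  have n4: "real n ^ 4 \<le> real n ^ 4 * L"
    using L by (simp add: mult_le_cancel_left1)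
  have "real n ^ 3 \<le> real n ^ 4" "real n ^ 2 \<le> real n ^ 4"
    using n by (auto intro: power_increasing)
  then have pow: "real n ^ 3 \<le> real n ^ 4 * L" "real n ^ 2 \<le> real n ^ 4 * L"
    using n4 by auto
  have sq: "real n ^ 2 \<le> real n ^ 3"
    using n by (intro power_increasing) auto
  have factor: "0 \<le> real n * L + 2"
    using L by simp
  have "0 \<le> 2 * real n ^ 3 - real n ^ 2"
    using sq zero_le_power[OF order.trans[OF zero_le_one n], of 3] by linarith
  then have "0 \<le> (2 * real n ^ 3 - real n ^ 2) * (real n * L + 2) + real n ^ 2"
    using factor by (rule add_nonneg_nonneg[OF mult_nonneg_nonneg zero_le_power2])
  moreover have "(2 * real n ^ 3 - real n ^ 2) * (real n * L + 2) \<le> 2 * real n ^ 3 * (real n * L + 2)"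
    using factor by (intro mult_right_mono) auto
  \<comment> \<open>Together with the summand \<open>n ^ 2\<close>, the coefficients add up to 7 = 2
    + 4 + 1, as \<open>L >= 1\<close> bounds each power by \<open>n ^ 4 * L\<close>.\<close>
  moreover have "2 * real n ^ 3 * (real n * L + 2) = 2 * (real n ^ 4 * L) + 4 * real n ^ 3"
    by (simp add: algebra_simps power_numeral_reduce)
  ultimately show ?thesis
    using pow unfolding op_bound_def L_def[symmetric] by linarith
qed

lemma ceiling_log_bounds:
  fixes q n :: nat
  assumes "q \<ge> 2" and "n \<ge> 1" and t: "t = nat \<lceil>log 2 (real q ^ n - 1)\<rceil>"
  shows "q ^ n - 1 \<le> 2 ^ t" and "real t \<le> real n * log 2 (real q) + 1"
proof -
  \<comment> \<open>The logarithm is then nonnegative, so \<open>nat\<close> does not alter the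
    ceiling; \<open>q = 2\<close>, \<open>n = 1\<close> is the boundary case with
    \<open>t = 0\<close>.\<close>
  have "2 \<le> real q ^ n"
    using assms(1,2) self_le_power[of "real q" n] by linarith
  then have ge1: "1 \<le> real q ^ n - 1"
    by simp
  then have nonneg: "0 \<le> log 2 (real q ^ n - 1)"
    by simp
  then have t': "real t = of_int \<lceil>log 2 (real q ^ n - 1)\<rceil>"
    by (simp add: t)
  then have "log 2 (real q ^ n - 1) \<le> real t"
    by simp
  then have "real q ^ n - 1 \<le> 2 ^ t"
    using ge1 by (simp add: log_le_iff powr_realpow)
  moreover have "real (q ^ n - 1) = real q ^ n - 1"
    using assms(1) by (simp add: of_nat_diff)
  ultimately show "q ^ n - 1 \<le> 2 ^ t"
    by (metis of_nat_le_iff of_nat_numeral of_nat_power)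
  have "log 2 (real q ^ n - 1) \<le> log 2 (real q ^ n)"
    using ge1 by (intro log_mono) auto
  also have "\<dots> = real n * log 2 (real q)"
    using assms(1) by (simp add: log_nat_power)
  finally show "real t \<le> real n * log 2 (real q) + 1"
    unfolding t' by linarith
qed

theorem mainTheorem5:
  fixes f :: "'a::{finite, field} vec \<Rightarrow> 'a vec"
    and F A B :: "'a exponent mat"
    and n q t :: nat
  assumes "n \<ge> 1"
    and "q = CARD('a)"
    and "monomial_dynamical_system n f"
    and "corresponding_matrix n f F"
    and "t = nat \<lceil>log 2 (real q ^ n - 1)\<rceil>"
    and "A = F ^\<^sub>m (2 ^ t)"
    and "B = F * A"
  shows "(fixed_point_system n f \<longleftrightarrow> A = B) \<and>
    result (fixed_point_test n t F) = (A, B, fixed_point_system n f) \<and>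
    real (cost (fixed_point_test n t F)) \<le> op_bound n q \<and>
    (\<forall>q'\<ge>2. (\<lambda>n'. op_bound n' q') \<in> O(\<lambda>n'. real n' ^ 4)) \<and>
    (\<lambda>(n', q'). op_bound n' q') \<in> O[at_top \<times>\<^sub>F at_top](\<lambda>(n', q'). real n' ^ 4 * log 2 (real q'))"
proof (intro conjI allI impI)
  have f: "f \<in> carrier_vec n \<rightarrow> carrier_vec n"
    using assms(3) by (simp add: monomial_dynamical_system_def)
  have F: "F \<in> carrier_mat n n"
    using assms(4) by (simp add: corresponding_matrix_def)
  have "q \<ge> 2"
    unfolding assms(2) by (rule card_field_ge_2)
  note t = ceiling_log_bounds[OF this assms(1) assms(5)]
  show iff: "fixed_point_system n f \<longleftrightarrow> A = B"
    unfolding assms(6,7) using t(1) assms(2)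
    by (intro fixed_point_system_iff_pow_mat f assms(4)) simp
  show "result (fixed_point_test n t F) = (A, B, fixed_point_system n f)"
    using result_fixed_point_test[OF assms(1) F, of t] by (simp add: iff assms(6,7))
  show "real (cost (fixed_point_test n t F)) \<le> op_bound n q"
    by (rule cost_fixed_point_test_le) (rule t(2))
  show "(\<lambda>n'. op_bound n' q') \<in> O(\<lambda>n'. real n' ^ 4)" if "q' \<ge> 2" for q'
    using abs_op_bound_le[OF that]
    by (intro bigoI[where c = "7 * log 2 (real q')"] always_eventually)
      (simp add: mult.assoc mult.left_commute mult.commute)
  \<comment> \<open>\<open>abs_op_bound_le\<close> requires \<open>q' >= 2\<close>, which holds
    eventually along the product filter.\<close>
  have "\<forall>\<^sub>F (n' :: nat, q') in at_top \<times>\<^sub>F at_top. q' \<ge> (2 :: nat)"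
    by (rule eventually_prod2[THEN iffD2]) (simp_all add: eventually_ge_at_top)
  then show "(\<lambda>(n', q'). op_bound n' q')
      \<in> O[at_top \<times>\<^sub>F at_top](\<lambda>(n', q'). real n' ^ 4 * log 2 (real q'))"
    by (intro bigoI[where c = 7])
      (auto elim!: eventually_mono intro: order.trans[OF abs_op_bound_le] simp: abs_mult)
qed

end
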